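(* Let $q$ be a power of an odd prime and $r\ge 1$ an integer. Let $A\subseteq\mathbb F_q^r$ be a progression-free set, and let $\alpha:=q^{-r}|A|$ be its density. Then there exist $g\in\mathbb F_q^r$ and a linear subspace $V<\mathbb F_q^r$ of co-dimension $1$ such that the density of $A$ on the affine subspace $g+V$ satisfies $$\frac{|A\cap(g+V)|}{|V|}\ \ge\ \frac{\alpha-q^{-r}}{1-\alpha}.$$
   Context: A subset $A$ of an abelian group is called progression-free if for any $a,b,c\in A$ with $a+c=2b$ one has $a=c$. *)

theory Defs
  imports "HOL-Analysis.Cartesian_Space" "HOL-Computational_Algebra.Primes"
begin

definition progression_free :: "'g::ab_group_add set \<Rightarrow> bool" where
  "progression_free A \<longleftrightarrow> (\<forall>a\<in>A. \<forall>b\<in>A. \<forall>c\<in>A. a + c = b + b \<longrightarrow> a = c)"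

end

theory Submission
  imports Defs "HOL-Number_Theory.Residues"
begin

text \<open>
  Let \<open>K\<close> be the largest number of points of \<open>A\<close> on an affine hyperplane and, for \<open>u \<noteq> 0\<close>, let
  \<open>h x\<close> count the points of \<open>A\<close> on \<open>{v. u \<cdot> v = x}\<close>. Then
  \<open>\<Sum>y d. (h (y - d) - h (y + d))\<^sup>2 * (K - h y) \<ge> 0\<close>. Expanding the square leaves the number of
  pairs \<open>a, b\<close> in \<open>A\<close> with \<open>u \<cdot> a = u \<cdot> b\<close> and the number of triples with
  \<open>u \<cdot> (a + c) = u \<cdot> (b + b)\<close>. Every nonzero vector is orthogonal to equally many \<open>u\<close>, so
  summing over all \<open>u \<noteq> 0\<close> reduces both to the solutions of \<open>a = b\<close> and of \<open>a + c = b + b\<close> in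
  \<open>A\<close>. The latter are trivial because \<open>A\<close> is progression-free, and the inequality collapses to
  \<open>(|A| - 1) * q\<^sup>r\<^sup>-\<^sup>1 \<le> K * (q\<^sup>r - |A|)\<close>.
\<close>

definition collisions :: "('a \<Rightarrow> 'b) \<Rightarrow> 'a set \<Rightarrow> ('a \<times> 'a) set" where
  "collisions f A = {(a, b) \<in> A \<times> A. f a = f b}"

definition midpoint_triples :: "('a \<Rightarrow> 'b::plus) \<Rightarrow> 'a set \<Rightarrow> ('a \<times> 'a \<times> 'a) set" where
  "midpoint_triples f A = {(a, b, c) \<in> A \<times> A \<times> A. f a + f c = f b + f b}"

lemma inj_double_if_odd_CARD:
  assumes "odd CARD('a::{ring_1,finite})"
  shows "inj (\<lambda>x::'a. x + x)"
proof (rule injI)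
  fix x y :: 'a
  assume "x + x = y + y"
  then have double_diff: "2 * (x - y) = 0"
    by (simp only: mult_2 add_diff_add[symmetric] diff_self)
  obtain k where CARD_eq: "CARD('a) = 2 * k + 1" using assms oddE by blast
  have "of_nat CARD('a) = (0::'a)" by (simp add: of_nat_eq_0_iff_char_dvd CHAR_dvd_CARD)
  then have "0 = of_nat CARD('a) * (x - y)" by simp
  also have "\<dots> = of_nat k * (2 * (x - y)) + (x - y)"
    by (simp add: CARD_eq mult.commute[of 2 k] distrib_right mult.assoc)
  also have "\<dots> = x - y" by (simp only: double_diff mult_zero_right add_0_left)
  finally show "x = y" by simp
qed

lemma inj_double_vec:
  assumes "inj (\<lambda>x::'a::plus. x + x)"
  shows "inj (\<lambda>v::'a ^ 'n. v + v)"
proof (rule injI)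
  fix v w :: "'a ^ 'n"
  assume "v + v = w + w"
  then have "v $ i + v $ i = w $ i + w $ i" for i by (metis vector_add_component)
  then have "v $ i = w $ i" for i using injD[OF assms] by blast
  then show "v = w" by (simp add: vec_eq_iff)
qed

lemma sum_minus_plus:
  fixes \<phi> :: "'g::{ab_group_add,finite} \<Rightarrow> 'g \<Rightarrow> 'b::comm_monoid_add"
  assumes "inj (\<lambda>x::'g. x + x)"
  shows "(\<Sum>y\<in>UNIV. \<Sum>d\<in>UNIV. \<phi> (y - d) (y + d)) = (\<Sum>x\<in>UNIV. \<Sum>z\<in>UNIV. \<phi> x z)"
proof -
  let ?p = "\<lambda>(y::'g, d). (y - d, y + d)"
  have "inj ?p"
  proof (rule injI, clarify)
    fix y d y' d' :: 'g
    assume minus: "y - d = y' - d'" and plus: "y + d = y' + d'"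
    have "y + y = (y - d) + (y + d)" by simp
    also have "\<dots> = y' + y'" unfolding minus plus by simp
    finally have "y = y'" using injD[OF assms] by blast
    then show "y = y' \<and> d = d'" using plus by simp
  qed
  then have "bij ?p" by (simp add: bij_def finite_UNIV_inj_surj)
  then show ?thesis
    using sum.reindex_bij_betw[of ?p UNIV UNIV "\<lambda>(x, z). \<phi> x z"]
    by (simp add: sum.cartesian_product case_prod_unfold)
qed

lemma weighted_square_sum_inequality:
  fixes h :: "'g::{ab_group_add,finite} \<Rightarrow> 'b::linordered_idom"
  assumes inj_double: "inj (\<lambda>x::'g. x + x)" and h_le: "\<And>x. h x \<le> K"
  shows "K * (\<Sum>x\<in>UNIV. h x)\<^sup>2
    \<le> (of_nat CARD('g) * K - (\<Sum>x\<in>UNIV. h x)) * (\<Sum>x\<in>UNIV. (h x)\<^sup>2)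
      + (\<Sum>y\<in>UNIV. \<Sum>d\<in>UNIV. h (y - d) * h y * h (y + d))"
    (is "K * ?n\<^sup>2 \<le> ?k * ?S + ?T")
proof -
  have "(\<Sum>d\<in>UNIV. (h (y - d))\<^sup>2) = ?S" for y
    by (rule sum.reindex_bij_witness[of _ "\<lambda>x. y - x" "\<lambda>d. y - d"]) auto
  moreover have "(\<Sum>d\<in>UNIV. (h (y + d))\<^sup>2) = ?S" for y
    by (rule sum.reindex_bij_witness[of _ "\<lambda>x. x - y" "\<lambda>d. y + d"]) auto
  ultimately have shifts: "(\<Sum>d\<in>UNIV. (h (y - d))\<^sup>2 * (K - h y)) = ?S * (K - h y)"
    "(\<Sum>d\<in>UNIV. (h (y + d))\<^sup>2 * (K - h y)) = ?S * (K - h y)" for y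
    by (simp_all flip: sum_distrib_right)
  have squares: "(\<Sum>y\<in>UNIV. ?S * (K - h y)) = ?k * ?S"
    by (simp add: sum_distrib_left[symmetric] sum_subtractf)
  have products: "(\<Sum>y\<in>UNIV. \<Sum>d\<in>UNIV. h (y - d) * h (y + d)) = ?n\<^sup>2"
    using sum_minus_plus[OF inj_double, of "\<lambda>x z. h x * h z"]
    by (simp add: sum_product power2_eq_square)
  have "0 \<le> (\<Sum>y\<in>UNIV. \<Sum>d\<in>UNIV. (h (y - d) - h (y + d))\<^sup>2 * (K - h y))"
    by (intro sum_nonneg mult_nonneg_nonneg) (use h_le in auto)
  also have "\<dots> = (\<Sum>y\<in>UNIV. \<Sum>d\<in>UNIV. (h (y - d))\<^sup>2 * (K - h y) + (h (y + d))\<^sup>2 * (K - h y)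
      + 2 * (h (y - d) * h y * h (y + d)) - 2 * K * (h (y - d) * h (y + d)))"
    by (intro sum.cong refl) (simp add: power2_eq_square algebra_simps)
  also have "\<dots> = 2 * (?k * ?S + ?T - K * ?n\<^sup>2)"
    by (simp only: sum.distrib sum_subtractf shifts squares products[symmetric]
        sum_distrib_left[symmetric]) (simp add: algebra_simps)
  finally show ?thesis by (simp add: zero_le_mult_iff)
qed

lemma card_eq_sum_card_fibres:
  fixes f :: "'a \<Rightarrow> 'b::finite"
  assumes "finite A"
  shows "card A = (\<Sum>x\<in>UNIV. card (A \<inter> f -` {x}))"
  using sum_fun_comp[of A UNIV f "\<lambda>_. 1 :: nat"] assms
  by (simp add: vimage_def Collect_conj_eq)

lemma card_collisions:
  fixes f :: "'a \<Rightarrow> 'b::finite"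
  assumes "finite A"
  shows "card (collisions f A) = (\<Sum>x\<in>UNIV. (card (A \<inter> f -` {x}))\<^sup>2)"
proof -
  have "finite (collisions f A)"
    using assms by (auto simp: collisions_def intro: finite_subset[of _ "A \<times> A"])
  then have "card (collisions f A) = (\<Sum>x\<in>UNIV. card (collisions f A \<inter> (f \<circ> fst) -` {x}))"
    by (rule card_eq_sum_card_fibres)
  moreover have "collisions f A \<inter> (f \<circ> fst) -` {x} = (A \<inter> f -` {x}) \<times> (A \<inter> f -` {x})" for x
    by (auto simp: collisions_def)
  ultimately show ?thesis by (simp add: card_cartesian_product power2_eq_square)
qed

lemma card_midpoint_triples:
  fixes f :: "'a \<Rightarrow> 'g::{ab_group_add,finite}"
  assumes "finite A"
  shows "card (midpoint_triples f A) = (\<Sum>y\<in>UNIV. \<Sum>d\<in>UNIV.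
    card (A \<inter> f -` {y - d}) * card (A \<inter> f -` {y}) * card (A \<inter> f -` {y + d}))"
proof -
  let ?M = "midpoint_triples f A"
  define centre where "centre = (\<lambda>(a, b, c :: 'a). (f b, f b - f a))"
  have "finite ?M"
    using assms by (auto simp: midpoint_triples_def intro: finite_subset[of _ "A \<times> A \<times> A"])
  then have "card ?M = (\<Sum>(y, d)\<in>UNIV. card (?M \<inter> centre -` {(y, d)}))"
    using card_eq_sum_card_fibres[of ?M centre] by (simp add: case_prod_unfold)
  moreover have "?M \<inter> centre -` {(y, d)}
      = (A \<inter> f -` {y - d}) \<times> (A \<inter> f -` {y}) \<times> (A \<inter> f -` {y + d})" for y d
    by (auto simp: midpoint_triples_def centre_def algebra_simps)
  ultimately show ?thesis
    by (simp add: card_cartesian_product sum.cartesian_product mult.assoc)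
qed

lemma collisions_midpoint_triples_inequality:
  fixes f :: "'a \<Rightarrow> 'g::{ab_group_add,finite}" and K :: real
  assumes "inj (\<lambda>x::'g. x + x)" and "finite A" and "\<And>x. real (card (A \<inter> f -` {x})) \<le> K"
  shows "K * (real (card A))\<^sup>2
    \<le> (real CARD('g) * K - real (card A)) * real (card (collisions f A))
      + real (card (midpoint_triples f A))"
proof -
  let ?h = "\<lambda>x. real (card (A \<inter> f -` {x}))"
  have "real (card A) = (\<Sum>x\<in>UNIV. ?h x)"
    using card_eq_sum_card_fibres[OF assms(2), of f] by simp
  then show ?thesis
    using weighted_square_sum_inequality[OF assms(1), of ?h K] assms
    by (simp add: card_collisions card_midpoint_triples)
qed

lemma progression_free_midpoint_triples:
  fixes A :: "'g::ab_group_add set"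
  assumes "inj (\<lambda>x::'g. x + x)" and "progression_free A"
  shows "midpoint_triples id A = (\<lambda>a. (a, a, a)) ` A"
proof (intro equalityI subsetI)
  fix t assume "t \<in> midpoint_triples id A"
  then obtain a b c where t: "t = (a, b, c)" "a \<in> A" "b \<in> A" "c \<in> A"
    and midpoint: "a + c = b + b"
    by (auto simp: midpoint_triples_def)
  then have "a = c" using assms(2) unfolding progression_free_def by blast
  moreover from this have "a = b" using injD[OF assms(1)] midpoint by blast
  ultimately show "t \<in> (\<lambda>a. (a, a, a)) ` A" using t by simp
qed (auto simp: midpoint_triples_def)

lemma scalar_product_commute:
  fixes u v :: "'a::comm_semiring_1 ^ 'n"
  shows "scalar_product u v = scalar_product v u"
  by (simp add: scalar_product_def mult.commute)

lemma scalar_product_add_right: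
  "scalar_product u (v + w) = scalar_product u v + scalar_product u w"
  by (simp add: scalar_product_def sum.distrib distrib_left)

lemma scalar_product_diff_right:
  fixes u v w :: "'a::ring_1 ^ 'n"
  shows "scalar_product u (v - w) = scalar_product u v - scalar_product u w"
  by (simp add: scalar_product_def sum_subtractf right_diff_distrib)

lemma scalar_product_scale_right:
  fixes u v :: "'a::comm_semiring_1 ^ 'n"
  shows "scalar_product u (c *s v) = c * scalar_product u v"
  by (simp add: scalar_product_def sum_distrib_left mult.left_commute)

lemma scalar_product_zero_left [simp]: "scalar_product 0 = (\<lambda>_. 0)"
  by (simp add: scalar_product_def fun_eq_iff)

lemma scalar_product_zero_right [simp]: "scalar_product u 0 = 0"
  by (simp add: scalar_product_def)

lemma scalar_product_surj:
  fixes u :: "'a::division_ring ^ 'n"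
  assumes "u \<noteq> 0"
  obtains v where "scalar_product u v = x"
proof -
  obtain i where u_nonzero: "u $ i \<noteq> 0"
    using assms by (auto simp: vec_eq_iff)
  have "scalar_product u (axis i (inverse (u $ i) * x)) = (\<Sum>j\<in>UNIV. if j = i then x else 0)"
    unfolding scalar_product_def
    by (rule sum.cong) (auto simp: axis_def u_nonzero mult.assoc[symmetric])
  then show thesis using that by simp
qed

lemma scalar_product_fibre_eq_translate:
  fixes u g :: "'a::ring_1 ^ 'n"
  shows "scalar_product u -` {scalar_product u g} = (+) g ` (scalar_product u -` {0})"
proof (intro equalityI subsetI)
  fix v assume "v \<in> scalar_product u -` {scalar_product u g}"
  then have "v = g + (v - g)" "v - g \<in> scalar_product u -` {0}"
    by (simp_all add: scalar_product_diff_right)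
  then show "v \<in> (+) g ` (scalar_product u -` {0})" by blast
qed (auto simp: scalar_product_add_right)

lemma subspace_scalar_product_kernel: "vec.subspace (scalar_product u -` {0})"
  by (auto simp: vec.subspace_def scalar_product_add_right scalar_product_scale_right)

lemma dim_scalar_product_kernel:
  fixes u :: "'f::field ^ 'n"
  assumes "u \<noteq> 0"
  shows "vec.dim (scalar_product u -` {0}) + 1 = CARD('n)"
proof -
  let ?V = "scalar_product u -` {0}"
  obtain g where g_eq_1: "scalar_product u g = 1" using scalar_product_surj[OF assms] .
  have "v - scalar_product u v *s g \<in> vec.span ?V" for v
    by (rule vec.span_base) (simp add: scalar_product_diff_right scalar_product_scale_right g_eq_1)
  then have "vec.span (insert g ?V) = UNIV" by (auto simp: vec.span_insert)
  then have "vec.dim (insert g ?V) = CARD('n)"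
    by (metis vec.dim_span vec_dim_card)
  moreover have "g \<notin> vec.span ?V"
    using g_eq_1 by (simp add: vec.span_eq_iff[THEN iffD2, OF subspace_scalar_product_kernel])
  ultimately show ?thesis by (simp add: vec.dim_insert)
qed

lemma card_scalar_product_kernel:
  fixes u :: "'f::{field,finite} ^ 'n"
  assumes "u \<noteq> 0"
  shows "card (scalar_product u -` {0}) = CARD('f) ^ (CARD('n) - 1)"
proof -
  have fibre: "card (scalar_product u -` {x}) = card (scalar_product u -` {0})" for x
  proof -
    obtain g where "scalar_product u g = x" using scalar_product_surj[OF assms] .
    then show ?thesis
      using scalar_product_fibre_eq_translate[of u g] by (simp add: card_image)
  qed
  have "CARD('f) ^ CARD('n) = (\<Sum>x\<in>UNIV. card (scalar_product u -` {x}))"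
    using card_eq_sum_card_fibres[of "UNIV :: ('f ^ 'n) set" "scalar_product u"] by simp
  also have "\<dots> = (\<Sum>x\<in>(UNIV :: 'f set). card (scalar_product u -` {0}))"
    by (intro sum.cong refl fibre)
  finally have "card (scalar_product u -` {0}) * CARD('f) = CARD('f) ^ CARD('n)" by simp
  also have "\<dots> = CARD('f) ^ (CARD('n) - 1) * CARD('f)"
    by (rule power_minus_mult[symmetric]) simp
  finally show ?thesis by simp
qed

definition affine_hyperplanes :: "('f::field ^ 'n) set set" where
  "affine_hyperplanes = {scalar_product u -` {x} | u x. u \<noteq> 0}"

lemma affine_hyperplanes_nonempty: "affine_hyperplanes \<noteq> {}"
proof -
  have "axis undefined 1 \<noteq> (0 :: 'a::field ^ 'b)" by (simp add: axis_eq_0_iff)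
  then show ?thesis unfolding affine_hyperplanes_def by blast
qed

lemma affine_hyperplaneE:
  fixes H :: "('f::{field,finite} ^ 'n) set"
  assumes "H \<in> affine_hyperplanes"
  obtains g V where "vec.subspace V" and "vec.dim V + 1 = CARD('n)"
    and "card V = CARD('f) ^ (CARD('n) - 1)" and "H = (+) g ` V"
proof -
  obtain u x where "u \<noteq> 0" and H_eq: "H = scalar_product u -` {x}"
    using assms by (auto simp: affine_hyperplanes_def)
  obtain g where "scalar_product u g = x" using scalar_product_surj[OF \<open>u \<noteq> 0\<close>] .
  then have "H = (+) g ` (scalar_product u -` {0})"
    using H_eq scalar_product_fibre_eq_translate by blast
  with subspace_scalar_product_kernel dim_scalar_product_kernel[OF \<open>u \<noteq> 0\<close>]
    card_scalar_product_kernel[OF \<open>u \<noteq> 0\<close>]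
  show thesis by (rule that)
qed

lemma sum_card_scalar_product_eq_0:
  fixes f :: "'a \<Rightarrow> 'f::{field,finite} ^ 'n"
  assumes "finite T"
  defines "q \<equiv> real CARD('f)" and "r \<equiv> CARD('n)"
  shows "(\<Sum>u\<in>UNIV - {0}. real (card {t \<in> T. scalar_product u (f t) = 0}))
    = (q ^ (r - 1) - 1) * real (card T) + (q ^ r - q ^ (r - 1)) * real (card {t \<in> T. f t = 0})"
proof -
  define orth where "orth w = card {u \<in> UNIV - {0}. scalar_product u w = 0}" for w :: "'f ^ 'n"
  have real_orth: "real (orth w) = q ^ (r - 1) - 1 + (q ^ r - q ^ (r - 1)) * of_bool (w = 0)"
    for w
  proof -
    have "{u \<in> UNIV - {0}. scalar_product u w = 0} = scalar_product w -` {0} - {0}"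
      by (auto simp: scalar_product_commute)
    then have "orth w = card (scalar_product w -` {0}) - 1"
      by (simp add: orth_def card_Diff_singleton)
    moreover have "card (scalar_product w -` {0})
        = (if w = 0 then CARD('f ^ 'n) else CARD('f) ^ (r - 1))"
      by (auto simp: r_def card_scalar_product_kernel)
    ultimately show ?thesis
      by (simp add: q_def r_def of_nat_diff Suc_leI)
  qed
  have "(\<Sum>u\<in>UNIV - {0}. card {t \<in> T. scalar_product u (f t) = 0}) = (\<Sum>t\<in>T. orth (f t))"
    by (rule sum_multicount_gen) (auto simp: orth_def assms(1))
  then have "(\<Sum>u\<in>UNIV - {0}. real (card {t \<in> T. scalar_product u (f t) = 0}))
      = (\<Sum>t\<in>T. real (orth (f t)))"
    by (simp only: of_nat_sum[symmetric])
  then show ?thesis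
    by (simp add: real_orth sum.distrib sum_distrib_left[symmetric] assms(1) Int_def)
qed

lemma sum_card_collisions_scalar_product:
  fixes A :: "('f::{field,finite} ^ 'n) set"
  defines "q \<equiv> real CARD('f)" and "r \<equiv> CARD('n)"
  shows "(\<Sum>u\<in>UNIV - {0}. real (card (collisions (scalar_product u) A)))
    = (q ^ (r - 1) - 1) * (real (card A))\<^sup>2 + (q ^ r - q ^ (r - 1)) * real (card A)"
proof -
  have pairs: "collisions (scalar_product u) A
      = {t \<in> A \<times> A. scalar_product u (fst t - snd t) = 0}" for u
    by (auto simp: collisions_def scalar_product_diff_right)
  have "{t \<in> A \<times> A. fst t - snd t = 0} = (\<lambda>a. (a, a)) ` A"
    by auto
  then have zeros: "card {t \<in> A \<times> A. fst t - snd t = 0} = card A"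
    by (simp add: card_image inj_on_def)
  show ?thesis
    unfolding pairs sum_card_scalar_product_eq_0[OF finite] zeros q_def r_def
    by (simp add: card_cartesian_product power2_eq_square)
qed

lemma sum_card_midpoint_triples_scalar_product:
  fixes A :: "('f::{field,finite} ^ 'n) set"
  defines "q \<equiv> real CARD('f)" and "r \<equiv> CARD('n)"
  shows "(\<Sum>u\<in>UNIV - {0}. real (card (midpoint_triples (scalar_product u) A)))
    = (q ^ (r - 1) - 1) * real (card A) ^ 3
      + (q ^ r - q ^ (r - 1)) * real (card (midpoint_triples id A))"
proof -
  define defect where "defect = (\<lambda>(a, b, c). a + c - (b + b) :: 'f ^ 'n)"
  have "scalar_product u (defect (a, b, c)) = 0
      \<longleftrightarrow> scalar_product u a + scalar_product u c = scalar_product u b + scalar_product u b"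
    for u a b c
    by (simp only: defect_def prod.case scalar_product_diff_right scalar_product_add_right
        right_minus_eq)
  then have triples: "midpoint_triples (scalar_product u) A
      = {t \<in> A \<times> A \<times> A. scalar_product u (defect t) = 0}" for u
    unfolding midpoint_triples_def by auto
  have zeros: "midpoint_triples id A = {t \<in> A \<times> A \<times> A. defect t = 0}"
    by (auto simp: midpoint_triples_def defect_def)
  show ?thesis
    unfolding triples zeros sum_card_scalar_product_eq_0[OF finite] q_def r_def
    by (simp add: card_cartesian_product power3_eq_cube mult.assoc)
qed

lemma progression_free_hyperplane_bound:
  fixes A :: "('f::{field,finite} ^ 'n) set" and K :: real
  assumes inj_double: "inj (\<lambda>x::'f. x + x)" and "progression_free A" and "A \<noteq> {}"
    and count_le: "\<And>H. H \<in> affine_hyperplanes \<Longrightarrow> real (card (A \<inter> H)) \<le> K"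
  defines "n \<equiv> real (card A)" and "q \<equiv> real CARD('f)" and "r \<equiv> CARD('n)"
  shows "(n - 1) * q ^ (r - 1) \<le> K * (q ^ r - n)"
proof -
  define L where "L = q ^ (r - 1)"
  define C where "C u = real (card (collisions (scalar_product u) A))" for u
  define M where "M u = real (card (midpoint_triples (scalar_product u) A))" for u
  have "n > 0" using \<open>A \<noteq> {}\<close> by (simp add: n_def card_gt_0_iff)
  have "card {0, 1 :: 'f} \<le> CARD('f)" by (rule card_mono) auto
  then have "q > 1" by (simp add: q_def)
  have q_pow_r: "q ^ r = q * L" by (simp add: L_def r_def power_eq_if)
  have "card (midpoint_triples id A) = card A"
    by (simp add: progression_free_midpoint_triples[OF inj_double_vec[OF inj_double] assms(2)]
        card_image inj_on_def)
  then have sum_M: "(\<Sum>u\<in>UNIV - {0}. M u) = (L - 1) * n ^ 3 + (q ^ r - L) * n"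
    unfolding M_def L_def n_def q_def r_def
    by (simp add: sum_card_midpoint_triples_scalar_product)
  have sum_C: "(\<Sum>u\<in>UNIV - {0}. C u) = (L - 1) * n\<^sup>2 + (q ^ r - L) * n"
    unfolding C_def L_def n_def q_def r_def by (rule sum_card_collisions_scalar_product)
  have "(q ^ r - 1) * (K * n\<^sup>2) = (\<Sum>u\<in>UNIV - {0 :: 'f ^ 'n}. K * n\<^sup>2)"
    by (simp add: q_def r_def card_Diff_singleton of_nat_diff Suc_leI)
  also have "\<dots> \<le> (\<Sum>u\<in>UNIV - {0}. (q * K - n) * C u + M u)"
    unfolding n_def q_def C_def M_def
    by (intro sum_mono collisions_midpoint_triples_inequality inj_double count_le)
       (auto simp: affine_hyperplanes_def)
  also have "\<dots> = (q * K - n) * ((L - 1) * n\<^sup>2 + (q ^ r - L) * n)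
      + ((L - 1) * n ^ 3 + (q ^ r - L) * n)"
    by (simp only: sum.distrib sum_distrib_left[symmetric] sum_C sum_M)
  finally have "0 \<le> (n * (q - 1)) * (K * (q ^ r - n) - (n - 1) * L)"
    unfolding q_pow_r by (simp add: algebra_simps power2_eq_square power3_eq_cube)
  moreover have "0 < n * (q - 1)" using \<open>n > 0\<close> \<open>q > 1\<close> by simp
  ultimately show ?thesis by (simp add: zero_le_mult_iff L_def)
qed

lemma progression_free_dense_hyperplane:
  fixes A :: "('f::{field,finite} ^ 'n) set"
  assumes "inj (\<lambda>x::'f. x + x)" and "progression_free A"
  defines "n \<equiv> real (card A)" and "q \<equiv> real CARD('f)" and "r \<equiv> CARD('n)"
  shows "\<exists>H\<in>affine_hyperplanes. (n - 1) * q ^ (r - 1) \<le> real (card (A \<inter> H)) * (q ^ r - n)"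
proof -
  let ?count = "\<lambda>H. card (A \<inter> H)"
  obtain H where "H \<in> affine_hyperplanes"
    and max: "Max (?count ` affine_hyperplanes) = ?count H"
    using obtains_MAX[OF finite affine_hyperplanes_nonempty, of ?count] .
  have densest: "real (?count G) \<le> real (?count H)" if "G \<in> affine_hyperplanes" for G
    using that by (simp flip: max)
  have "(n - 1) * q ^ (r - 1) \<le> real (?count H) * (q ^ r - n)"
  proof (cases "A = {}")
    case True
    then show ?thesis by (simp add: n_def q_def)
  next
    case False
    then show ?thesis
      unfolding n_def q_def r_def
      using assms(1,2) densest by (intro progression_free_hyperplane_bound)
  qed
  then show ?thesis using \<open>H \<in> affine_hyperplanes\<close> by blast
qed

theorem theorem1:
  fixes A :: "('f::{field,finite} ^ 'n) set"
    and q r :: nat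
    and \<alpha> :: real
  assumes "\<exists>p k. prime p \<and> odd p \<and> k \<ge> 1 \<and> q = p ^ k"
    and "CARD('f) = q"
    and "r \<ge> 1"
    and "CARD('n) = r"
    and "progression_free A"
    and "\<alpha> = real (card A) / real q ^ r"
  shows "\<exists>(g :: 'f ^ 'n) V. vec.subspace V \<and> vec.dim V + 1 = r \<and>
    real (card (A \<inter> (+) g ` V)) / real (card V) \<ge> (\<alpha> - 1 / real q ^ r) / (1 - \<alpha>)"
proof -
  define n where "n = real (card A)"
  define N where "N = real q ^ r"
  have "inj (\<lambda>x::'f. x + x)"
    using assms(1,2) by (intro inj_double_if_odd_CARD) auto
  then obtain H :: "('f ^ 'n) set" where "H \<in> affine_hyperplanes"
    and bound: "(n - 1) * real q ^ (r - 1) \<le> real (card (A \<inter> H)) * (N - n)"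
    using progression_free_dense_hyperplane[of A] assms(2,4,5) by (auto simp: n_def N_def)
  obtain g V where subspace_V: "vec.subspace V" and dim_V: "vec.dim V + 1 = r"
    and card_V: "card V = q ^ (r - 1)" and "H = (+) g ` V"
    using affine_hyperplaneE[OF \<open>H \<in> affine_hyperplanes\<close>, unfolded assms(2,4)] .
  have "N > 0" "n \<le> N" "card V > 0"
    using assms(2,4) card_V card_mono[of UNIV A]
    by (auto simp: n_def N_def simp flip: of_nat_power)
  have "(\<alpha> - 1 / real q ^ r) / (1 - \<alpha>) = (n - 1) / (N - n)"
    using \<open>N > 0\<close> assms(6) by (simp add: n_def N_def field_simps)
  also have "\<dots> \<le> real (card (A \<inter> H)) / real (card V)"
    using bound \<open>n \<le> N\<close> \<open>card V > 0\<close> by (cases "n = N") (simp_all add: card_V field_simps)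
  finally show ?thesis
    using subspace_V dim_V \<open>H = (+) g ` V\<close> by blast
qed

end
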